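(* Let $A\subseteq\omega^\omega$ be a $\mathsf{W}$-selfdual set. Then there is a map $\psi:\mathscr{P}(\omega)\to[A]_{\mathsf{W}}$ such that for every $X,Y\subseteq\omega$: (1) if $X\subseteq^*Y$, then $\psi(X)\leq_{\mathsf{L}(d_0)}\psi(Y)$; (2) if $\psi(X)\leq_{\mathsf{Lip}(d_0)}\psi(Y)$, then $X\subseteq^*Y$.
   Context: Base theory: $\mathsf{ZF}+\mathsf{DC}(\mathbb{R})$. $\omega^\omega$ is the Baire space with its product topology and standard metric $d(x,y)=0$ if $x=y$ and $d(x,y)=2^{-n}$ if $x\neq y$ and $n$ is least with $x(n)\neq y(n)$. The metric $d_0$ on $\omega^\omega$ is defined by: $d_0(x,y)=0$ if $x=y$; $d_0(x,y)=d(x,y)$ if $x(0)=y(0)$; $d_0(x,y)=\max\{x(0),y(0)\}$ if $x(0)\neq y(0)$. $\mathsf{W}$ is the set of continuous functions $\omega^\omega\to\omega^\omega$. $\mathsf{L}(d_0)$ is the set of $f:\omega^\omega\to\omega^\omega$ with $d_0(f(x),f(y))\leq d_0(x,y)$ for all $x,y$; $\mathsf{Lip}(d_0)$ is the set of $f$ for which there is a real $L\geq 0$ with $d_0(f(x),f(y))\leq L\cdot d_0(x,y)$ for all $x,y$. For a set of functions $\mathcal{F}$ and $A,B\subseteq\omega^\omega$, $A\leq_{\mathcal{F}}B$ iff $A=f^{-1}(B)$ for some $f\in\mathcal{F}$; $A\equiv_{\mathcal F}B$ iff $A\leq_{\mathcal F}B\leq_{\mathcal F}A$; $[A]_{\mathsf{W}}=\{B\subseteq\omega^\omega: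 B\equiv_{\mathsf{W}}A\}$. $A$ is $\mathsf{W}$-selfdual if $A\leq_{\mathsf{W}}\omega^\omega\setminus A$. For $X,Y\subseteq\omega$, $X\subseteq^*Y$ iff $X\setminus Y$ is finite. *)

theory Defs
  imports "HOL-Analysis.Function_Topology"
begin

type_synonym baire = "nat \<Rightarrow> nat"

definition baire_d :: "baire \<Rightarrow> baire \<Rightarrow> real" where
  "baire_d x y = (if x = y then 0 else (1/2) ^ (LEAST n. x n \<noteq> y n))"

definition baire_d0 :: "baire \<Rightarrow> baire \<Rightarrow> real" where
  "baire_d0 x y =
     (if x = y then 0
      else if x 0 = y 0 then baire_d x y
      else real (max (x 0) (y 0)))"

text \<open>Continuity refers to the library topology on functions, i.e. the product of the discrete
  topologies on the naturals.\<close>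

definition continuous_funs :: "(baire \<Rightarrow> baire) set" where
  "continuous_funs = {f. continuous_on UNIV f}"

definition nonexpansive_funs :: "('a \<Rightarrow> 'a \<Rightarrow> real) \<Rightarrow> ('a \<Rightarrow> 'a) set" where
  "nonexpansive_funs d = {f. \<forall>x y. d (f x) (f y) \<le> d x y}"

definition Lipschitz_funs :: "('a \<Rightarrow> 'a \<Rightarrow> real) \<Rightarrow> ('a \<Rightarrow> 'a) set" where
  "Lipschitz_funs d = {f. \<exists>L\<ge>0. \<forall>x y. d (f x) (f y) \<le> L * d x y}"

definition reducible :: "('a \<Rightarrow> 'a) set \<Rightarrow> 'a set \<Rightarrow> 'a set \<Rightarrow> bool" where
  "reducible F A B \<longleftrightarrow> (\<exists>f\<in>F. A = f -` B)"

definition reduc_equiv :: "('a \<Rightarrow> 'a) set \<Rightarrow> 'a set \<Rightarrow> 'a set \<Rightarrow> bool" where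
  "reduc_equiv F A B \<longleftrightarrow> reducible F A B \<and> reducible F B A"

definition degree_class :: "('a \<Rightarrow> 'a) set \<Rightarrow> 'a set \<Rightarrow> 'a set set" where
  "degree_class F A = {B. reduc_equiv F B A}"

definition selfdual :: "('a \<Rightarrow> 'a) set \<Rightarrow> 'a set \<Rightarrow> bool" where
  "selfdual F A \<longleftrightarrow> reducible F A (- A)"

definition almost_subset :: "nat set \<Rightarrow> nat set \<Rightarrow> bool" (infix \<open>\<subseteq>\<^sup>*\<close> 50) where
  "X \<subseteq>\<^sup>* Y \<longleftrightarrow> finite (X - Y)"

end

theory Submission
  imports Defs "HOL-Library.Countable"
begin

text \<open>A nonexpansive map for \<open>d\<^sub>0\<close> may collapse finitely many of the cones
  \<open>{x. x 0 = k}\<close> into a single one, while a Lipschitz map sends the \<open>k\<close>-th cone into the cones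
  with index at most \<open>L * k + C\<close> and is Lipschitz for \<open>d\<close> on it. So it suffices to place in the cones
  \<open>a n = (n + 1)!\<close>, which are sparse enough to defeat every linear bound, either the \<open>n\<close>-th or the
  next member of an increasing sequence of sets from the degree of \<open>A\<close>, none of which is Lipschitz
  reducible to its predecessor. Such a sequence exists without any determinacy: the Lipschitz maps
  have a continuous universal function \<open>V\<close>, so that \<open>{x. V x x \<notin> B}\<close> is not Lipschitz reducible to
  \<open>B\<close>, and by self-duality it still lies below \<open>A\<close>.\<close>

abbreviation (input) tail :: "(nat \<Rightarrow> 'a) \<Rightarrow> nat \<Rightarrow> 'a" where
  "tail x \<equiv> \<lambda>i. x (Suc i)"

section \<open>Continuity and the metric\<close>

lemma open_agree: "open {y :: baire. \<forall>i<N. y i = x i}"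
proof -
  have "{y :: baire. \<forall>i<N. y i = x i} = Pi\<^sub>E UNIV (\<lambda>i. if i < N then {x i} else UNIV)"
    by (auto simp: PiE_iff extensional_def split: if_splits)
  moreover have "open \<dots>"
    by (rule open_PiE) (auto intro: open_discrete finite_subset [of _ "{..<N}"])
  ultimately show ?thesis by simp
qed

lemma agree_subset_open:
  assumes "open (S :: baire set)" "x \<in> S"
  shows "\<exists>N. \<forall>y. (\<forall>i<N. y i = x i) \<longrightarrow> y \<in> S"
proof -
  obtain X where X: "x \<in> Pi\<^sub>E UNIV X" "finite {i. X i \<noteq> UNIV}" "Pi\<^sub>E UNIV X \<subseteq> S"
    using product_topology_open_contains_basis [of "\<lambda>_. euclidean" UNIV S x] assms
    by (auto simp: open_fun_def)
  then obtain N where N: "\<And>i. X i \<noteq> UNIV \<Longrightarrow> i < N"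
    using finite_nat_set_iff_bounded by auto
  have "y \<in> S" if y: "\<forall>i<N. y i = x i" for y
  proof -
    have "y i \<in> X i" for i
      using N y X(1) by (cases "X i = UNIV") (auto simp: PiE_iff)
    then show ?thesis using X(3) by (auto simp: PiE_iff)
  qed
  then show ?thesis by blast
qed

lemma continuous_baire_iff:
  fixes f :: "baire \<Rightarrow> baire"
  shows "continuous_on UNIV f \<longleftrightarrow>
    (\<forall>x m. \<exists>N. \<forall>y. (\<forall>i<N. y i = x i) \<longrightarrow> f y m = f x m)"
proof
  assume f: "continuous_on UNIV f"
  show "\<forall>x m. \<exists>N. \<forall>y. (\<forall>i<N. y i = x i) \<longrightarrow> f y m = f x m"
  proof (intro allI)
    fix x m
    have "open (f -` {z. \<forall>i<Suc m. z i = f x i})"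
      by (intro open_vimage open_agree f)
    from agree_subset_open [OF this, of x]
    obtain N where N: "\<And>y. (\<forall>i<N. y i = x i) \<Longrightarrow> y \<in> f -` {z. \<forall>i<Suc m. z i = f x i}"
      by (simp only: vimage_def mem_Collect_eq) blast
    have "f y m = f x m" if "\<forall>i<N. y i = x i" for y
      using N [OF that] by simp
    then show "\<exists>N. \<forall>y. (\<forall>i<N. y i = x i) \<longrightarrow> f y m = f x m" by blast
  qed
next
  assume f: "\<forall>x m. \<exists>N. \<forall>y. (\<forall>i<N. y i = x i) \<longrightarrow> f y m = f x m"
  have "open ((\<lambda>x. f x m) -` B)" for m and B :: "nat set"
  proof (subst open_subopen, intro ballI)
    fix x assume x: "x \<in> (\<lambda>x. f x m) -` B"
    obtain N where N: "\<And>y. (\<forall>i<N. y i = x i) \<Longrightarrow> f y m = f x m" using f by metis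
    have "{y. \<forall>i<N. y i = x i} \<subseteq> (\<lambda>x. f x m) -` B"
    proof
      fix y assume "y \<in> {y. \<forall>i<N. y i = x i}"
      then have "f y m = f x m" by (intro N) blast
      then show "y \<in> (\<lambda>x. f x m) -` B" using x by simp
    qed
    then show "\<exists>T. open T \<and> x \<in> T \<and> T \<subseteq> (\<lambda>x. f x m) -` B"
      using open_agree [of N x] by blast
  qed
  then show "continuous_on UNIV f"
    by (intro continuous_on_coordinatewise_then_product)
      (simp add: continuous_on_open_vimage)
qed

text \<open>The cones \<open>{x. x 0 = k}\<close> are open, so \<open>f k\<close> may vary
  arbitrarily with \<open>k\<close> without spoiling continuity.\<close>

lemma continuous_glue:
  fixes f :: "nat \<Rightarrow> baire \<Rightarrow> baire"
  assumes "\<And>k. continuous_on UNIV (f k)"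
  shows "continuous_on UNIV (\<lambda>x :: baire. f (x 0) (tail x))"
  unfolding continuous_baire_iff
proof (intro allI)
  fix x :: baire and m
  obtain N where N: "\<And>y. (\<forall>i<N. y i = tail x i) \<Longrightarrow> f (x 0) y m = f (x 0) (tail x) m"
    using assms unfolding continuous_baire_iff by metis
  show "\<exists>N. \<forall>y. (\<forall>i<N. y i = x i) \<longrightarrow> f (y 0) (tail y) m = f (x 0) (tail x) m"
  proof (intro exI [of _ "Suc N"] allI impI)
    fix y assume y: "\<forall>i<Suc N. y i = x i"
    then have "\<forall>i<N. tail y i = tail x i" by simp
    from N [OF this] show "f (y 0) (tail y) m = f (x 0) (tail x) m" using y by simp
  qed
qed

lemma continuous_case_nat: "continuous_on UNIV (case_nat k :: baire \<Rightarrow> baire)"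
  unfolding continuous_baire_iff
proof (intro allI)
  fix x :: baire and m
  show "\<exists>N. \<forall>y. (\<forall>i<N. y i = x i) \<longrightarrow> case_nat k y m = case_nat k x m"
    by (intro exI [of _ m]) (auto split: nat.split)
qed

lemma baire_d0_le_agree:
  assumes "k > 0" "\<And>i. i < k \<Longrightarrow> x i = y i"
  shows "baire_d0 x y \<le> (1/2) ^ k"
proof (cases "x = y")
  case False
  then have "x (LEAST n. x n \<noteq> y n) \<noteq> y (LEAST n. x n \<noteq> y n)"
    using LeastI_ex [of "\<lambda>n. x n \<noteq> y n"] by (simp add: fun_eq_iff)
  then have "k \<le> (LEAST n. x n \<noteq> y n)" using assms(2) not_le by blast
  then show ?thesis
    using assms False by (simp add: baire_d0_def baire_d_def power_decreasing)
qed (simp add: baire_d0_def)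

text \<open>Different heads force a distance of at least 1, so the bound yields a common head; its
  strictness carries the agreement up to index \<open>k\<close> itself.\<close>

lemma agree_if_baire_d0_less:
  assumes "baire_d0 x y < (1/2) ^ k" "i \<le> k"
  shows "x i = y i"
proof (cases "x = y")
  case False
  have "(1/2 :: real) ^ k \<le> 1" by (simp add: power_le_one)
  then have 0: "x 0 = y 0"
    using assms(1) False by (auto simp: baire_d0_def split: if_splits)
  then have "(1/2 :: real) ^ (LEAST n. x n \<noteq> y n) < (1/2) ^ k"
    using assms(1) False by (simp add: baire_d0_def baire_d_def)
  then have "k < (LEAST n. x n \<noteq> y n)"
    by (simp add: power_strict_decreasing_iff)
  then show ?thesis using assms(2) not_less_Least [of i "\<lambda>n. x n \<noteq> y n"] by auto
qed simp

lemma baire_d0_mono_agree: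
  assumes "x 0 = y 0"
    and "\<And>n. n > 0 \<Longrightarrow> (\<And>i. i < n \<Longrightarrow> x i = y i) \<Longrightarrow> (\<And>i. i < n \<Longrightarrow> u i = v i)"
  shows "baire_d0 u v \<le> baire_d0 x y"
proof (cases "x = y")
  case True
  then have "u i = v i" for i using assms(2) [of "Suc i" i] by simp
  then have "u = v" by (rule ext)
  then show ?thesis using True by (simp add: baire_d0_def)
next
  case False
  define n where "n = (LEAST n. x n \<noteq> y n)"
  have "x n \<noteq> y n" unfolding n_def using False LeastI_ex [of "\<lambda>n. x n \<noteq> y n"]
    by (simp add: fun_eq_iff)
  then have n: "n > 0" using assms(1) by (cases n) auto
  have agree: "x i = y i" if "i < n" for i
    using that not_less_Least [of i "\<lambda>n. x n \<noteq> y n"] unfolding n_def by simp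
  have "baire_d0 u v \<le> (1/2) ^ n"
    by (rule baire_d0_le_agree [OF n assms(2) [OF n agree]])
  then show ?thesis using False assms(1) by (simp add: baire_d0_def baire_d_def n_def)
qed

section \<open>Diagonalising against Lipschitz maps\<close>

text \<open>This is the Lipschitz condition for \<open>baire_d\<close> with constant 2^k / 2, read
  off initial segments; such a map can be coded by countably many values.\<close>

definition delayed :: "nat \<Rightarrow> (baire \<Rightarrow> baire) \<Rightarrow> bool" where
  "delayed k h \<longleftrightarrow> (\<forall>m x y. (\<forall>i<m + k. x i = y i) \<longrightarrow> h x m = h y m)"

text \<open>The first entry of the code \<open>y\<close> is the delay, the others list the values of the map.\<close>

definition univ_fun :: "baire \<Rightarrow> baire \<Rightarrow> baire" where
  "univ_fun y x = (\<lambda>m. y (Suc (to_nat (map x [0..<m + y 0]))))"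

lemma univ_fun_universal:
  assumes "delayed k h"
  shows "\<exists>y. univ_fun y = h"
proof
  \<comment> \<open>The entry for a list \<open>l\<close> is a value of \<open>h\<close> at
    \<open>l\<close> padded with zeros. The delay makes the padding harmless, and
    \<open>length l - k\<close> recovers \<open>m\<close> from a segment of length
    \<open>m + k\<close>.\<close>
  define y where "y = case_nat k (\<lambda>c. let l = from_nat c :: nat list in
     h (\<lambda>i. if i < length l then l ! i else 0) (length l - k))"
  show "univ_fun y = h"
  proof (intro ext)
    fix x m
    have "univ_fun y x m = h (\<lambda>i. if i < m + k then map x [0..<m + k] ! i else 0) m"
      by (simp add: univ_fun_def y_def)
    also have "\<dots> = h x m"
      using assms unfolding delayed_def by (auto simp del: upt_Suc)
    finally show "univ_fun y x m = h x m" .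
  qed
qed

lemma continuous_univ_fun_diag: "continuous_on UNIV (\<lambda>x. univ_fun x x)"
  unfolding continuous_baire_iff
proof (intro allI)
  fix x m
  define c where "c = to_nat (map x [0..<m + x 0])"
  show "\<exists>N. \<forall>y. (\<forall>i<N. y i = x i) \<longrightarrow> univ_fun y y m = univ_fun x x m"
  \<comment> \<open>The window covers the delay, the code entry at \<open>Suc c\<close> and the
    \<open>m + x 0\<close> entries of the argument that are looked up.\<close>
  proof (intro exI [of _ "Suc (Suc c) + (m + x 0)"] allI impI)
    fix y assume y: "\<forall>i<Suc (Suc c) + (m + x 0). y i = x i"
    then have "y 0 = x 0" "y (Suc c) = x (Suc c)" by simp_all
    moreover have "map y [0..<m + x 0] = map x [0..<m + x 0]" using y by simp
    ultimately show "univ_fun y y m = univ_fun x x m"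
      by (simp only: univ_fun_def c_def)
  qed
qed

text \<open>Stage \<open>n\<close> has members only in the cones 0 to \<open>n\<close>, which leaves
  cone \<open>Suc n\<close> free for a set diagonalising against stage \<open>n\<close>. Cone 0
  holds a copy of \<open>A\<close> at every stage.\<close>

primrec diag_chain :: "baire set \<Rightarrow> nat \<Rightarrow> baire set" where
  "diag_chain A 0 = {x. x 0 = 0 \<and> tail x \<in> A}"
| "diag_chain A (Suc n) = {x. if x 0 = Suc n then univ_fun (tail x) (tail x) \<notin> diag_chain A n
     else x \<in> diag_chain A n}"

lemma diag_chain_head_le: "x \<in> diag_chain A n \<Longrightarrow> x 0 \<le> n"
  by (induction n) (auto split: if_splits)

lemma diag_chain_mono_iff:
  assumes "m \<le> n" "x 0 \<le> m"
  shows "x \<in> diag_chain A n \<longleftrightarrow> x \<in> diag_chain A m"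
  using assms by (induction n rule: dec_induct) auto

text \<open>On cone \<open>Suc n\<close> the map \<open>h\<close> has a code \<open>y\<close>. At
  the point of that cone with tail \<open>y\<close>, membership says that the image under
  \<open>h\<close> misses \<open>diag_chain A n\<close>, contrary to the reduction.\<close>

lemma not_delayed_reduction_diag_chain:
  assumes "delayed k h"
  shows "diag_chain A (Suc n) \<noteq> h -` diag_chain A n"
proof
  assume eq: "diag_chain A (Suc n) = h -` diag_chain A n"
  have "delayed (Suc k) (\<lambda>t. h (case_nat (Suc n) t))"
    unfolding delayed_def
  proof (intro allI impI)
    fix m x y assume "\<forall>i<m + Suc k. x i = (y i :: nat)"
    then have "\<forall>i<m + k. case_nat (Suc n) x i = case_nat (Suc n) y i"
      by (auto split: nat.split)
    then show "h (case_nat (Suc n) x) m = h (case_nat (Suc n) y) m"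
      using assms unfolding delayed_def by blast
  qed
  then obtain y where "univ_fun y = (\<lambda>t. h (case_nat (Suc n) t))"
    using univ_fun_universal by blast
  then have "univ_fun y y = h (case_nat (Suc n) y)" by simp
  moreover have "case_nat (Suc n) y \<in> diag_chain A (Suc n) \<longleftrightarrow> univ_fun y y \<notin> diag_chain A n"
    by simp
  moreover have "case_nat (Suc n) y \<in> diag_chain A (Suc n) \<longleftrightarrow>
      h (case_nat (Suc n) y) \<in> diag_chain A n"
    by (simp only: eq vimage_eq)
  ultimately show False by metis
qed

text \<open>Serves to reduce stage \<open>m\<close> to a stage \<open>n\<close> with
  \<open>m \<le> n\<close>: heads above \<open>m\<close> never occur in stage \<open>m\<close>, and
  the constant sequence \<open>Suc n\<close> lies outside stage \<open>n\<close>.\<close>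

definition restrict_head :: "nat \<Rightarrow> nat \<Rightarrow> baire \<Rightarrow> baire" where
  "restrict_head m n t = (if t 0 \<le> m then t else (\<lambda>_. Suc n))"

lemma restrict_head_mem_iff:
  assumes "m \<le> n"
  shows "restrict_head m n t \<in> diag_chain A n \<longleftrightarrow> t \<in> diag_chain A m"
  using assms diag_chain_head_le [of t A m] diag_chain_head_le [of "\<lambda>_. Suc n" A n]
  by (auto simp: restrict_head_def diag_chain_mono_iff)

lemma reducible_glue:
  assumes "\<And>k. reducible continuous_funs (P k) A"
  shows "reducible continuous_funs {x. tail x \<in> P (x 0)} A"
proof -
  obtain f where f: "\<And>k. continuous_on UNIV (f k)" "\<And>k. P k = f k -` A"
    using assms unfolding reducible_def continuous_funs_def by (metis mem_Collect_eq)
  show ?thesis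
    unfolding reducible_def continuous_funs_def
    by (rule bexI [of _ "\<lambda>x. f (x 0) (tail x)"]) (auto simp: f continuous_glue)
qed

text \<open>The reduction is assembled cone by cone. The new cone carries the complement of a set
  already reducible to \<open>A\<close>, and self-duality absorbs the complement.\<close>

lemma diag_chain_reducible:
  assumes "selfdual continuous_funs A"
  shows "reducible continuous_funs (diag_chain A n) A"
proof (induction n)
  obtain s where s: "continuous_on UNIV s" "\<And>x. s x \<in> A \<longleftrightarrow> x \<notin> A"
    using assms unfolding selfdual_def reducible_def continuous_funs_def by blast
  {
    case 0
    \<comment> \<open>One of \<open>x\<close> and \<open>s x\<close> is outside \<open>A\<close>;
      such a point serves as the image of the empty cones.\<close>
    obtain w where w: "w \<notin> A" using s(2) by blast
    have "reducible continuous_funs (if k = 0 then A else {}) A" for k :: nat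
      unfolding reducible_def continuous_funs_def using w
      by (intro bexI [of _ "if k = 0 then (\<lambda>x. x) else (\<lambda>_. w)"]) auto
    moreover have "diag_chain A 0 = {x. tail x \<in> (if x 0 = 0 then A else {})}" by auto
    ultimately show ?case using reducible_glue [of "\<lambda>k. if k = 0 then A else {}" A] by simp
  next
    case (Suc n)
    then obtain f where f: "continuous_on UNIV f" "\<And>x. f x \<in> A \<longleftrightarrow> x \<in> diag_chain A n"
      unfolding reducible_def continuous_funs_def by blast
    define P where "P k = (if k = Suc n then {t. univ_fun t t \<notin> diag_chain A n}
      else {t. case_nat k t \<in> diag_chain A n})" for k
    have "reducible continuous_funs (P k) A" for k
    proof -
      define g where "g = (if k = Suc n then (\<lambda>t. s (f (univ_fun t t))) else (\<lambda>t. f (case_nat k t)))"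
      have "continuous_on UNIV g"
        unfolding g_def
        using continuous_on_compose2 [OF s(1) continuous_on_compose2
            [OF f(1) continuous_univ_fun_diag]]
          continuous_on_compose2 [OF f(1) continuous_case_nat [of k]]
        by simp
      moreover have "P k = g -` A" by (auto simp: P_def g_def s(2) f(2))
      ultimately show ?thesis unfolding reducible_def continuous_funs_def by blast
    qed
    moreover have "case_nat (x 0) (tail x) = x" for x :: baire
      by (auto simp: fun_eq_iff split: nat.split)
    then have "diag_chain A (Suc n) = {x. tail x \<in> P (x 0)}"
      by (auto simp: P_def)
    ultimately show ?case using reducible_glue [of P A] by simp
  }
qed

section \<open>The embedding\<close>

text \<open>The quotients of successive values are \<open>n + 2\<close>, hence unbounded; the shift
  avoids the repetition 0! = 1!.\<close>

definition pos :: "nat \<Rightarrow> nat" where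
  "pos n = fact (Suc n)"

lemma strict_mono_pos: "strict_mono pos"
  by (rule strict_mono_Suc_iff [THEN iffD2]) (simp add: pos_def)

lemma pos_greater_zero: "pos n > 0"
  by (simp add: pos_def)

definition level :: "nat set \<Rightarrow> nat \<Rightarrow> nat" where
  "level X k = (if k \<in> range pos then inv pos k + of_bool (inv pos k \<in> X) else 0)"

lemma level_pos [simp]: "level X (pos n) = n + of_bool (n \<in> X)"
  using strict_mono_pos by (simp add: level_def strict_mono_imp_inj_on)

text \<open>For \<open>m < n\<close> the level at \<open>pos m\<close> is at most
  \<open>m + 1\<close>, hence at most \<open>n\<close>; at \<open>pos n\<close> it is
  \<open>n\<close> because \<open>n\<close> is not in \<open>X\<close>.\<close>

lemma level_le_pos:
  assumes "k < pos (Suc n)" "n \<notin> X"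
  shows "level X k \<le> n"
proof (cases "k \<in> range pos")
  case True
  then obtain m where m: "k = pos m" by blast
  then have "m < Suc n" using assms(1) strict_mono_pos strict_mono_less by blast
  then show ?thesis using assms(2) m by (cases "m = n") auto
qed (simp add: level_def)

definition degree_embed :: "baire set \<Rightarrow> nat set \<Rightarrow> baire set" where
  "degree_embed A X = {x. tail x \<in> diag_chain A (level X (x 0))}"

lemma degree_embed_mem_degree_class:
  assumes "selfdual continuous_funs A"
  shows "degree_embed A X \<in> degree_class continuous_funs A"
proof -
  have "reducible continuous_funs (degree_embed A X) A"
    unfolding degree_embed_def by (intro reducible_glue diag_chain_reducible assms)
  moreover have "reducible continuous_funs A (degree_embed A X)"
    unfolding reducible_def continuous_funs_def
  proof (intro bexI CollectI)
    \<comment> \<open>The outer zero picks a cone of the embedding, the inner one the copy of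
      \<open>A\<close> in the stage placed there.\<close>
    show "continuous_on UNIV (\<lambda>x :: baire. case_nat (0 :: nat) (case_nat (0 :: nat) x))"
      by (rule continuous_on_compose2 [OF continuous_case_nat continuous_case_nat]) simp
    show "A = (\<lambda>x. case_nat 0 (case_nat 0 x)) -` degree_embed A X"
      by (auto simp: degree_embed_def diag_chain_mono_iff [of 0 "level X 0"])
  qed
  ultimately show ?thesis by (simp add: degree_class_def reduc_equiv_def)
qed

lemma nonexpansive_reduction:
  assumes "X \<subseteq>\<^sup>* Y"
  shows "reducible (nonexpansive_funs baire_d0) (degree_embed A X) (degree_embed A Y)"
proof -
  obtain N where N: "\<And>n. n \<in> X \<Longrightarrow> n \<notin> Y \<Longrightarrow> n < N"
    using assms unfolding almost_subset_def finite_nat_set_iff_bounded by blast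
  \<comment> \<open>All cones up to \<open>pos N\<close> are merged into cone \<open>pos N\<close>,
    whose level for \<open>Y\<close> is at least \<open>N\<close>; beyond it, members of
    \<open>X\<close> are members of \<open>Y\<close>.\<close>
  define g where "g k = max k (pos N)" for k
  have level: "level X k \<le> level Y (g k)" for k
  proof (cases "k \<in> range pos")
    case True
    then obtain n where n: "k = pos n" by blast
    then have "g k = pos (max n N)"
      using strict_mono_pos by (simp add: g_def max_def strict_mono_less_eq)
    then show ?thesis using n N [of n] by (cases "n = N"; cases "n \<in> Y") (auto simp: max_def)
  qed (simp add: level_def)
  define f where
    "f x = case_nat (g (x 0)) (restrict_head (level X (x 0)) (level Y (g (x 0))) (tail x))"
    for x :: baire
  have "f x \<in> degree_embed A Y \<longleftrightarrow> x \<in> degree_embed A X" for x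
    by (simp add: degree_embed_def f_def restrict_head_mem_iff level)
  then have "degree_embed A X = f -` degree_embed A Y" by blast
  moreover have "baire_d0 (f x) (f y) \<le> baire_d0 x y" for x y
  proof (cases "x 0 = y 0")
    case True
    show ?thesis
    proof (rule baire_d0_mono_agree [of x y, OF True])
      fix n i assume agree: "\<And>i. i < n \<Longrightarrow> x i = y i" and i: "i < n"
      \<comment> \<open>Once the head is fixed, output entry \<open>Suc j\<close> consults only the
        input entries 1 and \<open>Suc j\<close>, neither of which lies beyond
        \<open>i\<close>.\<close>
      show "f x i = f y i"
      proof (cases i)
        case (Suc j)
        then have "x (Suc 0) = y (Suc 0)" "x (Suc j) = y (Suc j)" using agree i by auto
        then show ?thesis using True Suc by (simp add: f_def restrict_head_def)
      qed (simp add: f_def True)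
    qed
  next
    case False
    then have d: "baire_d0 x y = real (max (x 0) (y 0))" by (auto simp: baire_d0_def)
    \<comment> \<open>Merged cones give image distance at most 1/2, below the distance of any two
      different heads. Otherwise the larger head exceeds \<open>pos N\<close> and is unchanged by
      \<open>g\<close>.\<close>
    show ?thesis
    proof (cases "g (x 0) = g (y 0)")
      case True
      then have "baire_d0 (f x) (f y) \<le> (1/2) ^ 1"
        by (intro baire_d0_le_agree) (auto simp: f_def)
      also have "\<dots> \<le> real (max (x 0) (y 0))" using False by simp
      finally show ?thesis using d by simp
    next
      case neq: False
      then have "baire_d0 (f x) (f y) = real (max (g (x 0)) (g (y 0)))"
        by (auto simp: baire_d0_def f_def dest: fun_cong [of _ _ 0])
      also have "max (g (x 0)) (g (y 0)) = max (x 0) (y 0)"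
        using neq by (auto simp: g_def max_def split: if_splits)
      finally show ?thesis using d by simp
    qed
  qed
  ultimately show ?thesis unfolding reducible_def nonexpansive_funs_def by blast
qed

lemma almost_subset_if_Lipschitz_reducible:
  assumes "reducible (Lipschitz_funs baire_d0) (degree_embed A X) (degree_embed A Y)"
  shows "X \<subseteq>\<^sup>* Y"
proof (rule ccontr)
  assume "\<not> X \<subseteq>\<^sup>* Y"
  then have inf: "infinite (X - Y)" by (simp add: almost_subset_def)
  obtain f L where L: "L \<ge> 0" "\<And>x y. baire_d0 (f x) (f y) \<le> L * baire_d0 x y"
    and f: "\<And>x. x \<in> degree_embed A X \<longleftrightarrow> f x \<in> degree_embed A Y"
    using assms unfolding reducible_def Lipschitz_funs_def by blast
  define c where "c = f (\<lambda>_. 0) 0"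
  obtain n where n: "n \<in> X" "n \<notin> Y" "n \<ge> max (nat \<lceil>L\<rceil>) c"
    using inf unfolding infinite_nat_iff_unbounded_le by blast
  \<comment> \<open>Comparison with the zero sequence: a head other than \<open>c\<close> is at most
    \<open>L * pos n\<close>, which is below \<open>(n + 2) * pos n = pos (Suc n)\<close>.\<close>
  have head: "f x 0 < pos (Suc n)" if x: "x 0 = pos n" for x
  proof (cases "f x 0 = c")
    case True
    moreover have "c < Suc (Suc n)" using n(3) by simp
    moreover have "Suc (Suc n) \<le> pos (Suc n)" unfolding pos_def by (rule fact_ge_self)
    ultimately show ?thesis by simp
  next
    case False
    then have "real (f x 0) \<le> baire_d0 (f x) (f (\<lambda>_. 0))"
      by (auto simp: baire_d0_def c_def)
    also have "\<dots> \<le> L * baire_d0 x (\<lambda>_. 0)" by (rule L)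
    also have "baire_d0 x (\<lambda>_. 0) = real (pos n)"
      using x pos_greater_zero [of n] by (auto simp: baire_d0_def)
    also have "L * real (pos n) < real (Suc (Suc n)) * real (pos n)"
    proof (rule mult_strict_right_mono)
      have "L \<le> real n" using n(3) by linarith
      then show "L < real (Suc (Suc n))" by simp
    qed (simp add: pos_greater_zero)
    also have "\<dots> = real (pos (Suc n))" by (simp add: pos_def algebra_simps)
    finally show ?thesis by simp
  qed
  define e where "e t = f (case_nat (pos n) t)" for t
  \<comment> \<open>All stages met by \<open>e\<close> are at most \<open>n\<close>, so they can be
    carried uniformly into stage \<open>n\<close>, whereas \<open>n \<in> X\<close> places stage
    \<open>Suc n\<close> in the source cone.\<close>
  define h where "h t = restrict_head (level Y (e t 0)) n (tail (e t))" for t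
  have "level Y (e t 0) \<le> n" for t
    unfolding e_def by (intro level_le_pos head) (use n in auto)
  then have "h t \<in> diag_chain A n \<longleftrightarrow> e t \<in> degree_embed A Y" for t
    by (simp add: h_def restrict_head_mem_iff degree_embed_def)
  moreover have "e t \<in> degree_embed A Y \<longleftrightarrow> t \<in> diag_chain A (Suc n)" for t
    using f [of "case_nat (pos n) t"] n(1) by (simp add: e_def degree_embed_def)
  ultimately have red: "diag_chain A (Suc n) = h -` diag_chain A n" by blast
  obtain K where K: "L < 2 ^ K" using real_arch_pow [of 2 L] by auto
  have "delayed K h"
    unfolding delayed_def
  proof (intro allI impI)
    fix m and s t :: baire assume st: "\<forall>i<m + K. s i = t i"
    have "baire_d0 (e s) (e t) \<le> L * baire_d0 (case_nat (pos n) s) (case_nat (pos n) t)"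
      unfolding e_def by (rule L)
    also have "\<dots> \<le> L * (1/2) ^ (Suc m + K)"
      by (intro mult_left_mono baire_d0_le_agree L) (use st in \<open>auto split: nat.split\<close>)
    also have "\<dots> < 2 ^ K * (1/2) ^ (Suc m + K)"
      by (intro mult_strict_right_mono K) simp
    also have "\<dots> = (1/2) ^ Suc m" by (simp add: power_add power_one_over)
    \<comment> \<open>Agreement up to \<open>Suc m\<close> is what \<open>h\<close> requires at
      \<open>m\<close>: entry 0 determines the level, entry 1 the case in
      \<open>restrict_head\<close>, and the tail shifts \<open>m\<close> to
      \<open>Suc m\<close>.\<close>
    finally have eq: "e s i = e t i" if "i \<le> Suc m" for i
      using agree_if_baire_d0_less that by blast
    then show "h s m = h t m" by (simp add: h_def restrict_head_def)
  qed
  then show False using red not_delayed_reduction_diag_chain by blast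
qed

theorem theorem5p4:
  fixes A :: "baire set"
  assumes "selfdual continuous_funs A"
  shows "\<exists>\<psi> :: nat set \<Rightarrow> baire set.
    (\<forall>X. \<psi> X \<in> degree_class continuous_funs A) \<and>
    (\<forall>X Y.
      (X \<subseteq>\<^sup>* Y \<longrightarrow> reducible (nonexpansive_funs baire_d0) (\<psi> X) (\<psi> Y)) \<and>
      (reducible (Lipschitz_funs baire_d0) (\<psi> X) (\<psi> Y) \<longrightarrow> X \<subseteq>\<^sup>* Y))"
  using degree_embed_mem_degree_class [OF assms] nonexpansive_reduction
    almost_subset_if_Lipschitz_reducible
  by (intro exI [of _ "degree_embed A"]) blast

end
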